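(* Let $T$ be a normal lax monad on a thin equipment $\mathcal K$. Let $J\colon A\nrightarrow B$ be a $T$-closed horizontal morphism between $T$-graphs and let $d\colon A\to M$ be a $T$-morphism into a $T$-cocomplete $T$-graph $M=(M,m_* )$, where $m\colon TM\to M$ is a vertical morphism. The left Kan extension $l\colon B\to M$ of $d$ along $J$ in $\mathcal K$, if it exists, is a $T$-morphism whenever $m\circ Tl$ is the left Kan extension of $m\circ Td$ along $TJ$.
   Context: A thin equipment $\mathcal K$ consists of two categories on the same collection of objects: one with composition $\circ$ and identities $\mathrm{id}$, whose morphisms $f\colon A\to C$ are called vertical, and one with composition $\odot$ (written in diagrammatic order) and identities $1_A$, whose morphisms $J\colon A\nrightarrow B$ are called horizontal; together with a collection of cells. A cell has a boundary consisting of a top $J\colon A\nrightarrow B$, a bottom $K\colon C\nrightarrow D$, a left side $f\colon A\to C$ and a right side $g\colon B\to D$, and is uniquely determined by its boundary; write $J\Rightarrow_{f,g}K$ if the cell with this boundary exists. The axioms are: (i) $J\Rightarrow_{f,g}K$ and $K\Rightarrow_{h,k}L$ imply $J\Rightarrow_{h\circ f,k\circ g}L$, and $J\Rightarrow_{f,g}K$ and $H\Rightarrow_{g,l}N$ imply $J\odot H\Rightarrow_{f,l}K\odot N$; (ii) $1_A\Rightarrow_{f,f}1_C$ for all $f\colon A\to C$ and $J\Rightarrow_{\mathrm{id},\mathrm{id}}J$ for all $J$; (iii) writing $J\le K$ for $J\Rightarrow_{\mathrm{id},\mathrm{id}}K$, if $J\le K$ and $K\le J$ then $J=K$; (iv)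 each vertical $f\colon A\to C$ has a companion $f_*\colon A\nrightarrow C$ with $f_*\Rightarrow_{f,\mathrm{id}_C}1_C$ and $1_A\Rightarrow_{\mathrm{id}_A,f}f_*$, and a conjoint $f^*\colon C\nrightarrow A$ with $f^*\Rightarrow_{\mathrm{id}_C,f}1_C$ and $1_A\Rightarrow_{f,\mathrm{id}_A}f^*$ (these are necessarily unique). A lax functor $F$ between thin equipments consists of a functor on the vertical categories together with an assignment $(J\colon A\nrightarrow B)\mapsto(FJ\colon FA\nrightarrow FB)$ such that $1_{FA}\le F1_A$, $FJ\odot FH\le F(J\odot H)$, and $J\Rightarrow_{f,g}K$ implies $FJ\Rightarrow_{Ff,Fg}FK$. It is normal if $F1_A=1_{FA}$ for all $A$. A transformation $\xi\colon F\Rightarrow G$ of lax functors is a natural transformation between the vertical functors such that $FJ\Rightarrow_{\xi_A,\xi_B}GJ$ for every $J\colon A\nrightarrow B$. A lax monad $T=(T,\mu,\iota)$ on $\mathcal K$ is a lax functor $T\colon\mathcal K\to\mathcal K$ with transformations $\mu\colon T^2\Rightarrow T$ and $\iota\colon\mathrm{id}_{\mathcal K}\Rightarrow T$ satisfying the usual monad associativity and unit axioms; it is normal if its underlying lax functor is. A $T$-graph is an object $A$ with a horizontal morphism $\alpha\colon TA\nrightarrow A$ such that $1_A\Rightarrow_{\iota_A,\mathrm{id}_A}\alpha$. A $T$-morphism $f\colon(A,\alpha)\to(C,\gamma)$ is a vertical morphism $f\colon A\to C$ with $\alpha\Rightarrow_{Tf,f}\gamma$. A $T$-graph $(M,\nu)$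 is $T$-cocomplete if $\nu=m_*$ for some vertical morphism $m\colon TM\to M$. A horizontal morphism $J\colon A\nrightarrow B$ between $T$-graphs $(A,\alpha)$ and $(B,\beta)$ is $T$-closed if $TJ\odot\beta\le\alpha\odot J$. Given $d\colon A\to M$ and $J\colon A\nrightarrow B$, a vertical morphism $l\colon B\to M$ is the left Kan extension of $d$ along $J$ if $J\Rightarrow_{d,l}1_M$ and, for all $H\colon B\nrightarrow C$ and $g\colon C\to M$, $J\odot H\Rightarrow_{d,g}1_M$ implies $H\Rightarrow_{l,g}1_M$. *)

theory Defs
  imports Main
begin

text \<open>\<open>cmp g f\<close> is the composite of \<open>f\<close> followed by \<open>g\<close>; it is meaningful only if
  \<open>cd f = dm g\<close>.\<close>

locale category =
  fixes Ob :: "'o set" and Ar :: "'m set"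
    and dm :: "'m \<Rightarrow> 'o" and cd :: "'m \<Rightarrow> 'o"
    and idn :: "'o \<Rightarrow> 'm" and cmp :: "'m \<Rightarrow> 'm \<Rightarrow> 'm"
  assumes dom_in [simp]: "f \<in> Ar \<Longrightarrow> dm f \<in> Ob"
    and cod_in [simp]: "f \<in> Ar \<Longrightarrow> cd f \<in> Ob"
    and id_in [simp]: "A \<in> Ob \<Longrightarrow> idn A \<in> Ar"
    and id_dom [simp]: "A \<in> Ob \<Longrightarrow> dm (idn A) = A"
    and id_cod [simp]: "A \<in> Ob \<Longrightarrow> cd (idn A) = A"
    and comp_in [simp]: "\<lbrakk>f \<in> Ar; g \<in> Ar; cd f = dm g\<rbrakk> \<Longrightarrow> cmp g f \<in> Ar"
    and comp_dom [simp]: "\<lbrakk>f \<in> Ar; g \<in> Ar; cd f = dm g\<rbrakk> \<Longrightarrow> dm (cmp g f) = dm f"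
    and comp_cod [simp]: "\<lbrakk>f \<in> Ar; g \<in> Ar; cd f = dm g\<rbrakk> \<Longrightarrow> cd (cmp g f) = cd g"
    and id_left [simp]: "f \<in> Ar \<Longrightarrow> cmp (idn (cd f)) f = f"
    and id_right [simp]: "f \<in> Ar \<Longrightarrow> cmp f (idn (dm f)) = f"
    and comp_assoc: "\<lbrakk>f \<in> Ar; g \<in> Ar; h \<in> Ar; cd f = dm g; cd g = dm h\<rbrakk>
      \<Longrightarrow> cmp h (cmp g f) = cmp (cmp h g) f"

text \<open>\<open>Ver\<close> and \<open>Hor\<close> are the vertical and the horizontal morphisms. \<open>g \<cdot>\<^bsub>K\<^esub> f\<close> is
  \<open>f\<close> followed by \<open>g\<close>, while \<open>J \<odot>\<^bsub>K\<^esub> H\<close> is \<open>J\<close> followed by \<open>H\<close>. As a cell is determined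
  by its boundary, cells are given by the relation \<open>cell K J f g L\<close>: there is a
  cell with top \<open>J\<close>, left side \<open>f\<close>, right side \<open>g\<close> and bottom \<open>L\<close>.\<close>

record ('o, 'v, 'h) equipment =
  Obj :: "'o set"
  Ver :: "'v set"
  vdom :: "'v \<Rightarrow> 'o"
  vcod :: "'v \<Rightarrow> 'o"
  vid :: "'o \<Rightarrow> 'v"
  vcomp :: "'v \<Rightarrow> 'v \<Rightarrow> 'v"  (infixr "\<cdot>\<index>" 70)
  Hor :: "'h set"
  hdom :: "'h \<Rightarrow> 'o"
  hcod :: "'h \<Rightarrow> 'o"
  hid :: "'o \<Rightarrow> 'h"
  hcomp :: "'h \<Rightarrow> 'h \<Rightarrow> 'h"  (infixr "\<odot>\<index>" 70)
  cell :: "'h \<Rightarrow> 'v \<Rightarrow> 'v \<Rightarrow> 'h \<Rightarrow> bool"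

definition vert :: "('o, 'v, 'h) equipment \<Rightarrow> 'v \<Rightarrow> 'o \<Rightarrow> 'o \<Rightarrow> bool" where
  "vert K f A C \<longleftrightarrow> f \<in> Ver K \<and> vdom K f = A \<and> vcod K f = C"

definition horiz :: "('o, 'v, 'h) equipment \<Rightarrow> 'h \<Rightarrow> 'o \<Rightarrow> 'o \<Rightarrow> bool" where
  "horiz K J A B \<longleftrightarrow> J \<in> Hor K \<and> hdom K J = A \<and> hcod K J = B"

definition hle :: "('o, 'v, 'h) equipment \<Rightarrow> 'h \<Rightarrow> 'h \<Rightarrow> bool" where
  "hle K J L \<longleftrightarrow> cell K J (vid K (hdom K J)) (vid K (hcod K J)) L"

definition is_companion :: "('o, 'v, 'h) equipment \<Rightarrow> 'v \<Rightarrow> 'h \<Rightarrow> bool" where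
  "is_companion K f J \<longleftrightarrow> horiz K J (vdom K f) (vcod K f)
     \<and> cell K J f (vid K (vcod K f)) (hid K (vcod K f))
     \<and> cell K (hid K (vdom K f)) (vid K (vdom K f)) f J"

definition is_conjoint :: "('o, 'v, 'h) equipment \<Rightarrow> 'v \<Rightarrow> 'h \<Rightarrow> bool" where
  "is_conjoint K f J \<longleftrightarrow> horiz K J (vcod K f) (vdom K f)
     \<and> cell K J (vid K (vcod K f)) f (hid K (vcod K f))
     \<and> cell K (hid K (vdom K f)) f (vid K (vdom K f)) J"

locale thin_equipment =
  V: category "Obj K" "Ver K" "vdom K" "vcod K" "vid K" "vcomp K" +
  H: category "Obj K" "Hor K" "hdom K" "hcod K" "hid K" "\<lambda>H J. hcomp K J H"
  for K :: "('o, 'v, 'h) equipment" (structure) +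
  assumes cell_boundary: "cell K J f g L \<Longrightarrow>
        J \<in> Hor K \<and> L \<in> Hor K \<and> vert K f (hdom K J) (hdom K L) \<and> vert K g (hcod K J) (hcod K L)"
    and cell_vcomp: "\<lbrakk>cell K J f g L; cell K L h k N\<rbrakk> \<Longrightarrow> cell K J (h \<cdot> f) (k \<cdot> g) N"
    and cell_hcomp: "\<lbrakk>cell K J f g L; cell K H g l N\<rbrakk> \<Longrightarrow> cell K (J \<odot> H) f l (L \<odot> N)"
    and cell_hid: "f \<in> Ver K \<Longrightarrow> cell K (hid K (vdom K f)) f f (hid K (vcod K f))"
    and hle_refl: "J \<in> Hor K \<Longrightarrow> hle K J J"
    and hle_antisym: "\<lbrakk>hle K J L; hle K L J\<rbrakk> \<Longrightarrow> J = L"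
    and ex_companion: "f \<in> Ver K \<Longrightarrow> \<exists>J. is_companion K f J"
    and ex_conjoint: "f \<in> Ver K \<Longrightarrow> \<exists>J. is_conjoint K f J"

definition companion :: "('o, 'v, 'h) equipment \<Rightarrow> 'v \<Rightarrow> 'h" where
  "companion K f = (THE J. is_companion K f J)"

lemma (in thin_equipment) companion_le:
  assumes "is_companion K f J" and "is_companion K f L"
  shows "hle K J L"
proof -
  have J: "J \<in> Hor K" "hdom K J = vdom K f" "hcod K J = vcod K f"
    and L: "L \<in> Hor K" "hdom K L = vdom K f" "hcod K L = vcod K f"
    using assms by (auto simp: is_companion_def horiz_def)
  have "cell K (hid K (vdom K f) \<odot> J) (vid K (vdom K f)) (vid K (vcod K f)) (L \<odot> hid K (vcod K f))"
    using assms cell_hcomp unfolding is_companion_def by blast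
  then show ?thesis
    using H.id_right[OF J(1)] H.id_left[OF L(1)] J L by (simp add: hle_def)
qed

lemma (in thin_equipment) is_companion_companion:
  assumes "f \<in> Ver K"
  shows "is_companion K f (companion K f)"
  unfolding companion_def
  by (rule theI') (use ex_companion[OF assms] companion_le hle_antisym in blast)

record ('o1, 'v1, 'h1, 'o2, 'v2, 'h2) efunctor =
  fobj :: "'o1 \<Rightarrow> 'o2"
  fver :: "'v1 \<Rightarrow> 'v2"
  fhor :: "'h1 \<Rightarrow> 'h2"

locale lax_functor =
  K: thin_equipment K + L: thin_equipment L
  for K :: "('o1, 'v1, 'h1) equipment" and L :: "('o2, 'v2, 'h2) equipment" +
  fixes F :: "('o1, 'v1, 'h1, 'o2, 'v2, 'h2) efunctor"
  assumes fobj_in: "A \<in> Obj K \<Longrightarrow> fobj F A \<in> Obj L"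
    and fver_vert: "vert K f A C \<Longrightarrow> vert L (fver F f) (fobj F A) (fobj F C)"
    and fver_id: "A \<in> Obj K \<Longrightarrow> fver F (vid K A) = vid L (fobj F A)"
    and fver_comp: "\<lbrakk>f \<in> Ver K; g \<in> Ver K; vcod K f = vdom K g\<rbrakk>
      \<Longrightarrow> fver F (g \<cdot>\<^bsub>K\<^esub> f) = fver F g \<cdot>\<^bsub>L\<^esub> fver F f"
    and fhor_horiz: "horiz K J A B \<Longrightarrow> horiz L (fhor F J) (fobj F A) (fobj F B)"
    and fhor_id: "A \<in> Obj K \<Longrightarrow> hle L (hid L (fobj F A)) (fhor F (hid K A))"
    and fhor_comp: "\<lbrakk>J \<in> Hor K; H \<in> Hor K; hcod K J = hdom K H\<rbrakk>
      \<Longrightarrow> hle L (fhor F J \<odot>\<^bsub>L\<^esub> fhor F H) (fhor F (J \<odot>\<^bsub>K\<^esub> H))"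
    and fcell: "cell K J f g N \<Longrightarrow> cell L (fhor F J) (fver F f) (fver F g) (fhor F N)"

locale normal_lax_functor = lax_functor +
  assumes fhor_id_eq: "A \<in> Obj K \<Longrightarrow> fhor F (hid K A) = hid L (fobj F A)"

definition efunctor_id :: "('o, 'v, 'h, 'o, 'v, 'h) efunctor" where
  "efunctor_id = \<lparr>fobj = id, fver = id, fhor = id\<rparr>"

definition efunctor_comp ::
  "('o2, 'v2, 'h2, 'o3, 'v3, 'h3) efunctor \<Rightarrow> ('o1, 'v1, 'h1, 'o2, 'v2, 'h2) efunctor
    \<Rightarrow> ('o1, 'v1, 'h1, 'o3, 'v3, 'h3) efunctor" where
  "efunctor_comp G F = \<lparr>fobj = fobj G \<circ> fobj F, fver = fver G \<circ> fver F, fhor = fhor G \<circ> fhor F\<rparr>"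

lemma (in thin_equipment) lax_functor_id: "lax_functor K K efunctor_id"
  by unfold_locales (auto simp: efunctor_id_def intro: hle_refl)

lemma lax_functor_comp:
  assumes "lax_functor K L F" and "lax_functor L N G"
  shows "lax_functor K N (efunctor_comp G F)"
proof -
  interpret F: lax_functor K L F by fact
  interpret G: lax_functor L N G by fact
  have hle_trans: "hle N X Z" if XY: "hle N X Y" and YZ: "hle N Y Z" for X Y Z
  proof -
    have "X \<in> Hor N" "hdom N Y = hdom N X" "hcod N Y = hcod N X"
      using G.L.cell_boundary[OF XY[unfolded hle_def]] by (auto simp: vert_def)
    then show ?thesis
      using G.L.cell_vcomp[OF XY[unfolded hle_def] YZ[unfolded hle_def]]
        G.L.V.id_left[of "vid N (hdom N X)"] G.L.V.id_left[of "vid N (hcod N X)"]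
      by (simp add: hle_def)
  qed
  have mono: "hle N (fhor G X) (fhor G Y)" if XY: "hle L X Y" for X Y
  proof -
    have X: "X \<in> Hor L"
      using F.L.cell_boundary[OF XY[unfolded hle_def]] by simp
    then have "horiz N (fhor G X) (fobj G (hdom L X)) (fobj G (hcod L X))"
      using G.fhor_horiz by (simp add: horiz_def)
    then show ?thesis
      using G.fcell[OF XY[unfolded hle_def]] X by (simp add: hle_def horiz_def G.fver_id)
  qed
  show ?thesis
  proof unfold_locales
    fix A assume "A \<in> Obj K"
    then show "hle N (hid N (fobj (efunctor_comp G F) A)) (fhor (efunctor_comp G F) (hid K A))"
      using hle_trans[OF G.fhor_id mono[OF F.fhor_id]] F.fobj_in by (simp add: efunctor_comp_def)
  next
    fix J H assume *: "J \<in> Hor K" "H \<in> Hor K" "hcod K J = hdom K H"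
    have "fhor F J \<in> Hor L" "fhor F H \<in> Hor L" "hcod L (fhor F J) = hdom L (fhor F H)"
      using * F.fhor_horiz by (auto simp: horiz_def)
    from hle_trans[OF G.fhor_comp[OF this] mono[OF F.fhor_comp[OF *]]]
    show "hle N (fhor (efunctor_comp G F) J \<odot>\<^bsub>N\<^esub> fhor (efunctor_comp G F) H)
        (fhor (efunctor_comp G F) (J \<odot>\<^bsub>K\<^esub> H))"
      by (simp add: efunctor_comp_def)
  next
    fix f g assume *: "f \<in> Ver K" "g \<in> Ver K" "vcod K f = vdom K g"
    then have "fver F f \<in> Ver L" "fver F g \<in> Ver L" "vcod L (fver F f) = vdom L (fver F g)"
      using F.fver_vert by (auto simp: vert_def)
    then show "fver (efunctor_comp G F) (g \<cdot>\<^bsub>K\<^esub> f)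
        = fver (efunctor_comp G F) g \<cdot>\<^bsub>N\<^esub> fver (efunctor_comp G F) f"
      using * by (simp add: efunctor_comp_def F.fver_comp G.fver_comp)
  qed (auto simp: efunctor_comp_def F.fver_id G.fver_id F.fobj_in
      intro: F.fobj_in G.fobj_in F.fver_vert G.fver_vert F.fhor_horiz G.fhor_horiz F.fcell G.fcell)
qed

locale transformation =
  F: lax_functor K L F + G: lax_functor K L G
  for K :: "('o1, 'v1, 'h1) equipment" and L :: "('o2, 'v2, 'h2) equipment" and F G +
  fixes \<xi> :: "'o1 \<Rightarrow> 'v2"
  assumes component: "A \<in> Obj K \<Longrightarrow> vert L (\<xi> A) (fobj F A) (fobj G A)"
    and naturality: "vert K f A C \<Longrightarrow> \<xi> C \<cdot>\<^bsub>L\<^esub> fver F f = fver G f \<cdot>\<^bsub>L\<^esub> \<xi> A"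
    and component_cell: "horiz K J A B \<Longrightarrow> cell L (fhor F J) (\<xi> A) (\<xi> B) (fhor G J)"

locale lax_monad =
  lax_functor K K T +
  mult: transformation K K "efunctor_comp T T" T \<mu> +
  unit: transformation K K efunctor_id T \<iota>
  for K :: "('o, 'v, 'h) equipment" and T \<mu> \<iota> +
  assumes mult_assoc: "A \<in> Obj K \<Longrightarrow> \<mu> A \<cdot>\<^bsub>K\<^esub> fver T (\<mu> A) = \<mu> A \<cdot>\<^bsub>K\<^esub> \<mu> (fobj T A)"
    and unit_left: "A \<in> Obj K \<Longrightarrow> \<mu> A \<cdot>\<^bsub>K\<^esub> \<iota> (fobj T A) = vid K (fobj T A)"
    and unit_right: "A \<in> Obj K \<Longrightarrow> \<mu> A \<cdot>\<^bsub>K\<^esub> fver T (\<iota> A) = vid K (fobj T A)"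

locale normal_lax_monad = lax_monad K T \<mu> \<iota> + normal_lax_functor K K T
  for K :: "('o, 'v, 'h) equipment" and T \<mu> \<iota>

context
  fixes K :: "('o, 'v, 'h) equipment" and T :: "('o, 'v, 'h, 'o, 'v, 'h) efunctor"
begin

fun T_graph :: "('o \<Rightarrow> 'v) \<Rightarrow> 'o \<times> 'h \<Rightarrow> bool" where
  "T_graph \<iota> (A, \<alpha>) \<longleftrightarrow> A \<in> Obj K \<and> horiz K \<alpha> (fobj T A) A
     \<and> cell K (hid K A) (\<iota> A) (vid K A) \<alpha>"

fun T_morphism :: "'o \<times> 'h \<Rightarrow> 'o \<times> 'h \<Rightarrow> 'v \<Rightarrow> bool" where
  "T_morphism (A, \<alpha>) (C, \<gamma>) f \<longleftrightarrow> vert K f A C \<and> cell K \<alpha> (fver T f) f \<gamma>"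

fun T_cocomplete :: "'o \<times> 'h \<Rightarrow> bool" where
  "T_cocomplete (M, \<nu>) \<longleftrightarrow> (\<exists>m. vert K m (fobj T M) M \<and> \<nu> = companion K m)"

fun T_closed :: "'o \<times> 'h \<Rightarrow> 'o \<times> 'h \<Rightarrow> 'h \<Rightarrow> bool" where
  "T_closed (A, \<alpha>) (B, \<beta>) J \<longleftrightarrow> horiz K J A B \<and> hle K (fhor T J \<odot>\<^bsub>K\<^esub> \<beta>) (\<alpha> \<odot>\<^bsub>K\<^esub> J)"

end

text \<open>\<open>left_kan K d J l\<close>: \<open>l\<close> is the left Kan extension of \<open>d\<close> along \<open>J\<close>.\<close>

definition left_kan :: "('o, 'v, 'h) equipment \<Rightarrow> 'v \<Rightarrow> 'h \<Rightarrow> 'v \<Rightarrow> bool" where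
  "left_kan K d J l \<longleftrightarrow> (\<exists>A B M. vert K d A M \<and> horiz K J A B \<and> vert K l B M
     \<and> cell K J d l (hid K M)
     \<and> (\<forall>C H g. horiz K H B C \<longrightarrow> vert K g C M \<longrightarrow>
          cell K (J \<odot>\<^bsub>K\<^esub> H) d g (hid K M) \<longrightarrow> cell K H l g (hid K M)))"

end

theory Submission
  imports Defs
begin

text \<open>A companion bottom can be traded for an identity bottom: \<open>H \<Rightarrow>\<^bsub>f,g\<^esub> m\<^sub>*\<close> holds exactly when
  \<open>H \<Rightarrow>\<^bsub>m \<cdot> f,g\<^esub> 1\<close> does (\<open>cell_companion_iff\<close>). So, writing \<open>T\<close> for the functor on both kinds
  of morphism, a vertical \<open>f: C \<rightarrow> M\<close> is a \<open>T\<close>-morphism \<open>(C, \<gamma>) \<rightarrow> (M, m\<^sub>*)\<close> iff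
  \<open>\<gamma> \<Rightarrow>\<^bsub>m \<cdot> T f,f\<^esub> 1\<^bsub>M\<^esub>\<close>.

  For \<open>f = l\<close>, this is a cell of the kind that the universal property of \<open>m \<cdot> T l\<close>, as the left Kan
  extension of \<open>m \<cdot> T d\<close> along \<open>T J\<close>, produces: it suffices to find a cell
  \<open>T J \<odot> \<beta> \<Rightarrow>\<^bsub>m \<cdot> T d,l\<^esub> 1\<^bsub>M\<^esub>\<close>. Closedness, \<open>T J \<odot> \<beta> \<le> \<alpha> \<odot> J\<close>, splits that cell into
  \<open>\<alpha> \<Rightarrow>\<^bsub>m \<cdot> T d,d\<^esub> 1\<^bsub>M\<^esub>\<close>, which says that \<open>d\<close> is a \<open>T\<close>-morphism, and \<open>J \<Rightarrow>\<^bsub>d,l\<^esub> 1\<^bsub>M\<^esub>\<close>, the cell that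
  comes with the Kan extension \<open>l\<close>.\<close>

lemma (in thin_equipment) cell_hle_top:
  assumes "hle K J L" and "cell K L f g N"
  shows "cell K J f g N"
proof -
  have "vdom K f = hdom K L" "vdom K g = hcod K L" "f \<in> Ver K" "g \<in> Ver K"
    using cell_boundary[OF assms(2)] by (auto simp: vert_def)
  moreover have "J \<in> Hor K" "hdom K J = hdom K L" "hcod K J = hcod K L"
    using cell_boundary[OF assms(1)[unfolded hle_def]] by (auto simp: vert_def)
  ultimately show ?thesis
    using cell_vcomp[OF assms(1)[unfolded hle_def] assms(2)] V.id_right[of f] V.id_right[of g]
    by simp
qed

lemma (in thin_equipment) cell_hcomp_hid_bottom:
  assumes "cell K J f g (hid K M)" and "cell K H g k (hid K M)" and "M \<in> Obj K"
  shows "cell K (J \<odot> H) f k (hid K M)"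
  using cell_hcomp[OF assms(1,2)] H.id_left[of "hid K M"] assms(3) by simp

text \<open>The two cells of the companion give the two directions: \<open>m\<^sub>* \<Rightarrow>\<^bsub>m,id\<^esub> 1\<close> is pasted below, and
  \<open>1 \<Rightarrow>\<^bsub>id,m\<^esub> m\<^sub>*\<close>, stacked under the identity cell of \<open>f\<close>, is pasted on the left.\<close>

lemma (in thin_equipment) cell_companion_iff:
  assumes m: "m \<in> Ver K" and f: "vert K f (hdom K H) (vdom K m)"
    and H: "H \<in> Hor K"
  shows "cell K H f g (companion K m) \<longleftrightarrow> cell K H (m \<cdot> f) g (hid K (vcod K m))"
proof -
  let ?c = "companion K m" and ?M = "vcod K m"
  have c: "?c \<in> Hor K" "hdom K ?c = vdom K m" "hcod K ?c = ?M"
    and counit: "cell K ?c m (vid K ?M) (hid K ?M)"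
    and unit: "cell K (hid K (vdom K m)) (vid K (vdom K m)) m ?c"
    using is_companion_companion[OF m] by (auto simp: is_companion_def horiz_def)
  have f': "f \<in> Ver K" "vdom K f = hdom K H" "vcod K f = vdom K m"
    using f by (auto simp: vert_def)
  show ?thesis
  proof
    assume cell: "cell K H f g ?c"
    then have "vid K ?M \<cdot> g = g"
      using cell_boundary[OF cell] c V.id_left[of g] by (auto simp: vert_def)
    then show "cell K H (m \<cdot> f) g (hid K ?M)"
      using cell_vcomp[OF cell counit] by simp
  next
    assume cell: "cell K H (m \<cdot> f) g (hid K ?M)"
    have "cell K (hid K (hdom K H)) f (m \<cdot> f) ?c"
      using cell_vcomp[OF cell_hid[OF f'(1)], of "vid K (vdom K m)" m ?c] unit f' V.id_left[of f]
      by simp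
    from cell_hcomp[OF this cell] show "cell K H f g ?c"
      using H.id_right[of H] H.id_left[of ?c] H c by simp
  qed
qed

lemma left_kan_cell:
  assumes "left_kan K d J l" and "vert K d A M"
  shows "cell K J d l (hid K M)"
  using assms by (auto simp: left_kan_def vert_def)

lemma left_kan_universal:
  assumes "left_kan K d J l" and "horiz K J A B" and "vert K d A M"
    and "horiz K H B C" and "vert K g C M"
    and "cell K (J \<odot>\<^bsub>K\<^esub> H) d g (hid K M)"
  shows "cell K H l g (hid K M)"
  using assms by (auto simp: left_kan_def vert_def horiz_def)

theorem theorem7p8:
  fixes K :: "('o, 'v, 'h) equipment"
    and T :: "('o, 'v, 'h, 'o, 'v, 'h) efunctor"
    and \<mu> \<iota> :: "'o \<Rightarrow> 'v"
    and A B M :: 'o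
    and \<alpha> \<beta> \<nu> J :: 'h
    and m d l :: 'v
  assumes "thin_equipment K"
    and "normal_lax_monad K T \<mu> \<iota>"
    and "T_graph K T \<iota> (A, \<alpha>)"
    and "T_graph K T \<iota> (B, \<beta>)"
    and "T_closed K T (A, \<alpha>) (B, \<beta>) J"
    and "T_graph K T \<iota> (M, \<nu>)"
    and "T_cocomplete K T (M, \<nu>)"
    and "vert K m (fobj T M) M"
    and "\<nu> = companion K m"
    and "T_morphism K T (A, \<alpha>) (M, \<nu>) d"
    and "left_kan K d J l"
    and "left_kan K (m \<cdot>\<^bsub>K\<^esub> fver T d) (fhor T J) (m \<cdot>\<^bsub>K\<^esub> fver T l)"
  shows "T_morphism K T (B, \<beta>) (M, \<nu>) l"
proof -
  interpret thin_equipment K by fact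
  interpret T: normal_lax_monad K T \<mu> \<iota> by fact
  have m: "m \<in> Ver K" "vdom K m = fobj T M" "vcod K m = M" and M: "M \<in> Obj K"
    using \<open>vert K m (fobj T M) M\<close> \<open>T_graph K T \<iota> (M, \<nu>)\<close> by (auto simp: vert_def)
  have \<alpha>: "horiz K \<alpha> (fobj T A) A" and \<beta>: "horiz K \<beta> (fobj T B) B"
    using \<open>T_graph K T \<iota> (A, \<alpha>)\<close> \<open>T_graph K T \<iota> (B, \<beta>)\<close> by auto
  have J: "horiz K J A B" and closed: "hle K (fhor T J \<odot>\<^bsub>K\<^esub> \<beta>) (\<alpha> \<odot>\<^bsub>K\<^esub> J)"
    using \<open>T_closed K T (A, \<alpha>) (B, \<beta>) J\<close> by auto
  have d: "vert K d A M" and d_cell: "cell K \<alpha> (fver T d) d (companion K m)"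
    using \<open>T_morphism K T (A, \<alpha>) (M, \<nu>) d\<close> \<open>\<nu> = companion K m\<close> by auto
  have l: "vert K l B M" and l_cell: "cell K J d l (hid K M)"
    using \<open>left_kan K d J l\<close> d J left_kan_cell
    by (auto simp: left_kan_def vert_def horiz_def)
  note Td = T.fver_vert[OF d] and Tl = T.fver_vert[OF l]
  have mTd: "vert K (m \<cdot>\<^bsub>K\<^esub> fver T d) (fobj T A) M"
    using Td m by (auto simp: vert_def)
  have "cell K \<alpha> (m \<cdot>\<^bsub>K\<^esub> fver T d) d (hid K M)"
    using cell_companion_iff[OF m(1), of "fver T d" \<alpha> d] d_cell Td \<alpha> m
    by (simp add: horiz_def)
  from cell_hle_top[OF closed cell_hcomp_hid_bottom[OF this l_cell M]]
  have "cell K (fhor T J \<odot>\<^bsub>K\<^esub> \<beta>) (m \<cdot>\<^bsub>K\<^esub> fver T d) l (hid K M)" .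
  from left_kan_universal[OF assms(12) T.fhor_horiz[OF J] mTd \<beta> l this]
  have "cell K \<beta> (m \<cdot>\<^bsub>K\<^esub> fver T l) l (hid K M)" .
  then have "cell K \<beta> (fver T l) l (companion K m)"
    using cell_companion_iff[OF m(1), of "fver T l" \<beta> l] Tl \<beta> m
    by (simp add: horiz_def)
  then show ?thesis
    using l \<open>\<nu> = companion K m\<close> by simp
qed

end
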